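(* Any polynomial $P$ on $SG$ satisfies $$\partial_TP(q_0)+\partial_TP(q_1)+\partial_TP(q_2)=0,$$ and more generally, for every cell $F_w(SG)$, the sum of the tangential derivatives of $P$ (with respect to that cell) at the three boundary points $F_wq_0,F_wq_1,F_wq_2$ of the cell vanishes.
   Context: Let $q_0,q_1,q_2$ be the vertices of an equilateral triangle in the plane (indices mod 3), $F_i(x)=\frac12(x+q_i)$, and let $SG$ (Sierpinski gasket) be the unique nonempty compact set with $SG=\bigcup_{i=0}^2F_i(SG)$. For a word $w=(w_1,\dots,w_m)\in\{0,1,2\}^m$, $|w|=m$, put $F_w=F_{w_1}\circ\cdots\circ F_{w_m}$; $F_w(SG)$ is a cell of level $m$. $V_0=\{q_0,q_1,q_2\}$, $V_m=\bigcup_iF_i(V_{m-1})$, $V_*=\bigcup_mV_m$; for distinct $x,y\in V_m$, $x\sim_my$ means $x,y$ lie in a common cell of level $m$. Laplacian: $u\in\mathrm{dom}\,\Delta$ with $\Delta u=f$ means that $u,f$ are continuous on $SG$ and $\frac32 5^m\sum_{y\sim_mx}(u(y)-u(x))\to f(x)$ as $m\to\infty$, uniformly for $x\in V_*\setminus V_0$. Powers $\Delta^n$ are defined iteratively. A polynomial is a function $P$ on $SG$ with $\Delta^{j}P=0$ for some $j$. Tangential derivative: $\partial_Tu(q_j)=\lim_{m\to\infty}5^m\big(u(F_j^mq_{j+1})-u(F_j^mq_{j-1})\big)$; with respect to a cell $F_w(SG)$, $\partial_Tu(F_wq_j)=5^{|w|}\,\partial_T(u\circ F_w)(q_j)$.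 *)

theory Defs
  imports "HOL-Analysis.Analysis"
begin

text \<open>
  The vertices are \<open>q :: 3 \<Rightarrow> real^2\<close>; the index type \<open>3\<close> is the ring of integers mod 3, so
  \<open>q (j + 1)\<close> and \<open>q (j - 1)\<close> have their indices taken mod 3. Functions on the gasket are
  total functions on the plane whose values off \<open>SG q\<close> are never used.
\<close>

definition equilateral :: "(3 \<Rightarrow> real^2) \<Rightarrow> bool" where
  "equilateral q \<longleftrightarrow> (\<exists>d>0. \<forall>i j. i \<noteq> j \<longrightarrow> dist (q i) (q j) = d)"

definition sg_map :: "(3 \<Rightarrow> real^2) \<Rightarrow> 3 \<Rightarrow> real^2 \<Rightarrow> real^2" where
  "sg_map q i x = (1/2) *\<^sub>R (x + q i)"

definition SG :: "(3 \<Rightarrow> real^2) \<Rightarrow> (real^2) set" where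
  "SG q = (THE K. K \<noteq> {} \<and> compact K \<and> K = (\<Union>i. sg_map q i ` K))"

primrec sg_word :: "(3 \<Rightarrow> real^2) \<Rightarrow> 3 list \<Rightarrow> real^2 \<Rightarrow> real^2" where
  "sg_word q [] = id"
| "sg_word q (i # w) = sg_map q i \<circ> sg_word q w"

definition cell :: "(3 \<Rightarrow> real^2) \<Rightarrow> 3 list \<Rightarrow> (real^2) set" where
  "cell q w = sg_word q w ` SG q"

primrec verts :: "(3 \<Rightarrow> real^2) \<Rightarrow> nat \<Rightarrow> (real^2) set" where
  "verts q 0 = range q"
| "verts q (Suc m) = (\<Union>i. sg_map q i ` verts q m)"

definition adjacent :: "(3 \<Rightarrow> real^2) \<Rightarrow> nat \<Rightarrow> real^2 \<Rightarrow> real^2 \<Rightarrow> bool" where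
  "adjacent q m x y \<longleftrightarrow> x \<in> verts q m \<and> y \<in> verts q m \<and> x \<noteq> y \<and>
     (\<exists>w. length w = m \<and> x \<in> cell q w \<and> y \<in> cell q w)"

definition discrete_laplacian ::
    "(3 \<Rightarrow> real^2) \<Rightarrow> nat \<Rightarrow> (real^2 \<Rightarrow> real) \<Rightarrow> real^2 \<Rightarrow> real" where
  "discrete_laplacian q m u x = 3/2 * 5^m * (\<Sum>y | adjacent q m x y. u y - u x)"

text \<open>
  A point \<open>x\<close> has neighbours at level \<open>m\<close> only if it lies in \<open>verts q m\<close>. Uniform convergence on
  the union of all \<open>verts q m\<close> minus \<open>verts q 0\<close> therefore means an error bound at stage \<open>m\<close> that is
  uniform over those points which are already vertices of level \<open>m\<close>.
\<close>

definition has_laplacian ::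
    "(3 \<Rightarrow> real^2) \<Rightarrow> (real^2 \<Rightarrow> real) \<Rightarrow> (real^2 \<Rightarrow> real) \<Rightarrow> bool" where
  "has_laplacian q u f \<longleftrightarrow> continuous_on (SG q) u \<and> continuous_on (SG q) f \<and>
     (\<forall>e>0. \<forall>\<^sub>F m in sequentially. \<forall>x \<in> verts q m - verts q 0.
        \<bar>discrete_laplacian q m u x - f x\<bar> < e)"

primrec has_laplacian_power ::
    "(3 \<Rightarrow> real^2) \<Rightarrow> nat \<Rightarrow> (real^2 \<Rightarrow> real) \<Rightarrow> (real^2 \<Rightarrow> real) \<Rightarrow> bool" where
  "has_laplacian_power q 0 u f \<longleftrightarrow> (\<forall>x\<in>SG q. u x = f x)"
| "has_laplacian_power q (Suc n) u f \<longleftrightarrow>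
     (\<exists>g. has_laplacian q u g \<and> has_laplacian_power q n g f)"

definition sg_polynomial :: "(3 \<Rightarrow> real^2) \<Rightarrow> (real^2 \<Rightarrow> real) \<Rightarrow> bool" where
  "sg_polynomial q P \<longleftrightarrow> (\<exists>j. has_laplacian_power q j P (\<lambda>_. 0))"

definition tangential_quotient ::
    "(3 \<Rightarrow> real^2) \<Rightarrow> (real^2 \<Rightarrow> real) \<Rightarrow> 3 \<Rightarrow> nat \<Rightarrow> real" where
  "tangential_quotient q u j m =
     5^m * (u ((sg_map q j ^^ m) (q (j + 1))) - u ((sg_map q j ^^ m) (q (j - 1))))"

text \<open>
  \<open>lim\<close> is unspecified for a divergent sequence, so a claim about \<open>tangential_deriv\<close> is meaningful
  only together with \<open>tangentially_differentiable\<close>.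
\<close>

definition tangentially_differentiable ::
    "(3 \<Rightarrow> real^2) \<Rightarrow> (real^2 \<Rightarrow> real) \<Rightarrow> 3 \<Rightarrow> bool" where
  "tangentially_differentiable q u j \<longleftrightarrow> convergent (tangential_quotient q u j)"

definition tangential_deriv :: "(3 \<Rightarrow> real^2) \<Rightarrow> (real^2 \<Rightarrow> real) \<Rightarrow> 3 \<Rightarrow> real" where
  "tangential_deriv q u j = lim (tangential_quotient q u j)"

text \<open>The derivative at \<open>sg_word q w (q j)\<close> with respect to \<open>cell q w\<close>.\<close>

definition cell_tangential_deriv ::
    "(3 \<Rightarrow> real^2) \<Rightarrow> 3 list \<Rightarrow> (real^2 \<Rightarrow> real) \<Rightarrow> 3 \<Rightarrow> real" where
  "cell_tangential_deriv q w u j = 5 ^ length w * tangential_deriv q (u \<circ> sg_word q w) j"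

end

theory Submission
  imports Defs
begin

text \<open>
  The functional \<open>L P = \<partial>\<^sub>T P(q\<^sub>0) + \<partial>\<^sub>T P(q\<^sub>1) + \<partial>\<^sub>T P(q\<^sub>2)\<close> is invariant under the rotations of
  the triangle and changes sign under its reflections. A polynomial, on the other hand, is
  determined by the values of its iterated Laplacians at the three vertices, and the permutation
  action of the symmetry group on those three values contains no copy of the sign representation.
  Hence \<open>L\<close> has to vanish on polynomials.

  Concretely, let \<open>antisym P\<close> be the alternating sum of \<open>P\<close> over the six symmetries. It vanishes
  at every vertex (\<open>antisym_vertex\<close>), and it commutes with the Laplacian. If \<open>antisym (\<Delta> P)\<close> is
  zero, then \<open>antisym P\<close> is harmonic with zero boundary values, hence zero by \<open>maximum_principle\<close>;
  induction on the number of Laplacians gives \<open>antisym P = 0\<close> for every polynomial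
  (\<open>antisym_polynomial\<close>). Evaluated at the point \<open>F\<^sub>0\<^sup>m q\<^sub>1\<close>, this identity says that the three
  tangential difference quotients of level \<open>m\<close> sum to zero, for every single \<open>m\<close>
  (\<open>sum_tangential_quotient\<close>).

  What remains is that the limits exist. Both this and the maximum principle rest on one estimate,
  \<open>lap_bound\<close>: if \<open>\<Delta> u = f\<close> and \<open>\<bar>f\<bar> \<le> B\<close>, then at each interior vertex of each level \<open>m\<close>, not
  only of high levels, the differences of \<open>u\<close> to the neighbours sum to at most \<open>2 B / (3 * 5\<^sup>m)\<close>
  in absolute value. It comes from solving the graph Laplacian at the midpoints of a cell for the
  values there (\<open>mid_value\<close>), which bounds level \<open>m\<close> by five times level \<open>m + 1\<close>. Applied to the
  difference of \<open>u\<close> and its reflection, it bounds the change from one difference quotient to the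
  next by the oscillation of \<open>\<Delta> u\<close> on small cells at the vertex (\<open>tangential_step\<close>). That
  oscillation decays like \<open>(3/5)\<^sup>m\<close> when \<open>\<Delta> u\<close> itself has a Laplacian (\<open>decay\<close>), so the quotients
  converge.

  Composition with the map of a cell turns polynomials into polynomials, so the claim for cells is
  the claim for the whole gasket.
\<close>

section \<open>Indices mod 3, words and the attractor\<close>

lemma three_cases: "(k::3) = i \<or> k = i + 1 \<or> k = i - 1"
proof -
  have c: "x = 0 \<or> x = 1 \<or> x = 2" for x :: 3 using exhaust_3[of x] by auto
  have "(3::3) = 0" "(2::3) = -1" by simp_all
  show ?thesis using c[of "k - i"] by (auto simp: algebra_simps)
qed

lemma three_distinct [simp]:
  fixes i :: 3
  shows "i + 1 \<noteq> i" "i - 1 \<noteq> i" "i + 1 \<noteq> i - 1" "i \<noteq> i + 1" "i \<noteq> i - 1" "i - 1 \<noteq> i + 1"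
  by (auto simp: algebra_simps)

lemma three_shift [simp]:
  fixes i :: 3
  shows "i + 1 + 1 = i - 1" "i - 1 - 1 = i + 1"
  by (auto simp: algebra_simps)

lemma UNIV_three: "(UNIV :: 3 set) = {i, i + 1, i - 1}"
  using three_cases[of _ i] by auto

lemma sum_three:
  fixes f :: "3 \<Rightarrow> 'a::comm_monoid_add"
  shows "(\<Sum>k\<in>UNIV. f k) = f i + f (i + 1) + f (i - 1)"
  by (simp add: UNIV_three[of i] add.assoc)

lemma sg_map_fixpoint [simp]: "sg_map q i (q i) = q i"
  by (simp add: sg_map_def scaleR_add_right flip: scaleR_2 scaleR_left_distrib)

lemma sg_map_swap: "sg_map q i (q j) = sg_map q j (q i)"
  by (simp add: sg_map_def add.commute)

lemma sg_map_inj [simp]: "sg_map q i x = sg_map q i y \<longleftrightarrow> x = y"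
  by (simp add: sg_map_def)

lemma dist_sg_map: "dist (sg_map q i x) (sg_map q i y) = dist x y / 2"
proof -
  have "sg_map q i x - sg_map q i y = (1/2) *\<^sub>R (x - y)"
    by (simp add: sg_map_def algebra_simps)
  then show ?thesis by (simp add: dist_norm)
qed

lemma continuous_sg_map: "continuous_on S (sg_map q i)"
  unfolding sg_map_def by (intro continuous_intros)

lemma sg_word_append: "sg_word q (v @ w) x = sg_word q v (sg_word q w x)"
  by (induction v) auto

lemma sg_word_inj [simp]: "sg_word q w x = sg_word q w y \<longleftrightarrow> x = y"
  by (induction w) auto

lemma vertsE:
  assumes "x \<in> verts q m"
  obtains w i where "length w = m" "x = sg_word q w (q i)"
  using assms
proof (induction m arbitrary: x thesis)
  case 0
  then show ?case by fastforce
next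
  case (Suc m)
  from Suc.prems(2) obtain j y where j: "y \<in> verts q m" "x = sg_map q j y" by auto
  obtain w i where "length w = m" "y = sg_word q w (q i)" using Suc.IH j(1) by blast
  then show ?case using Suc.prems(1)[of "j # w" i] j by simp
qed

lemma sg_word_in_verts: "sg_word q w (q i) \<in> verts q (length w)"
  by (induction w) auto

lemma verts_Suc_mono: "verts q m \<subseteq> verts q (Suc m)"
proof (induction m)
  case 0
  have "q i \<in> verts q (Suc 0)" for i
    using sg_map_fixpoint[of q i] by (auto intro!: exI[of _ i] image_eqI[of _ _ "q i"])
  then show ?case by auto
next
  case (Suc m)
  then have "(\<Union>i. sg_map q i ` verts q m) \<subseteq> (\<Union>i. sg_map q i ` verts q (Suc m))" by blast
  then show ?case by (simp only: verts.simps(2)[of q m, symmetric] verts.simps(2)[of q "Suc m", symmetric])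
qed

lemma verts_mono: "m \<le> n \<Longrightarrow> verts q m \<subseteq> verts q n"
  using lift_Suc_mono_le[of "verts q" m n] verts_Suc_mono by blast

lemma vertices_subset_verts: "q i \<in> verts q m"
  using verts_mono[of 0 m q] by auto

definition all_verts :: "(3 \<Rightarrow> real^2) \<Rightarrow> (real^2) set" where
  "all_verts q = (\<Union>m. verts q m)"

lemma all_verts_self_similar: "all_verts q = (\<Union>i. sg_map q i ` all_verts q)"
proof -
  have "all_verts q = (\<Union>m. verts q (Suc m))"
    unfolding all_verts_def using verts_Suc_mono by blast
  also have "\<dots> = (\<Union>i. sg_map q i ` all_verts q)"
    unfolding all_verts_def by auto
  finally show ?thesis .
qed

lemma bounded_all_verts: "bounded (all_verts q)"
proof -
  define R where "R = (\<Sum>i\<in>UNIV. norm (q i))"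
  have R: "norm (q i) \<le> R" for i
    unfolding R_def by (rule member_le_sum) auto
  have "norm x \<le> R" if "x \<in> verts q m" for x m
    using that
  proof (induction m arbitrary: x)
    case 0
    then show ?case using R by auto
  next
    case (Suc m)
    then obtain i y where iy: "y \<in> verts q m" "x = sg_map q i y" by auto
    have "norm (y + q i) \<le> R + R"
      using Suc.IH[OF iy(1)] R[of i] norm_triangle_ineq[of y "q i"] by linarith
    then show ?case by (simp add: iy(2) sg_map_def)
  qed
  then show ?thesis unfolding all_verts_def bounded_iff by blast
qed

text \<open>
  The maps halve distances, so self-similarity of both sets improves a bound \<open>C\<close> for the distance
  from points of \<open>K\<close> to \<open>L\<close> to \<open>C / 2 ^ n\<close> for every \<open>n\<close>. Used in both directions, this is the
  uniqueness of the attractor.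
\<close>

lemma compact_self_similar_subset:
  assumes K: "compact K" "K = (\<Union>i. sg_map q i ` K)"
    and L: "compact L" "L \<noteq> {}" "L = (\<Union>i. sg_map q i ` L)"
  shows "K \<subseteq> L"
proof
  fix x0 assume x0: "x0 \<in> K"
  have "bounded ((\<lambda>x. infdist x L) ` K)"
    by (intro compact_imp_bounded compact_continuous_image continuous_intros K)
  then obtain C where "norm (infdist x L) \<le> C" if "x \<in> K" for x
    unfolding bounded_iff by blast
  then have C: "infdist x L \<le> C" if "x \<in> K" for x
    using that by fastforce
  have "infdist x L \<le> C / 2 ^ n" if "x \<in> K" for x n
    using that
  proof (induction n arbitrary: x)
    case 0
    then show ?case using C by simp
  next
    case (Suc n)
    then obtain i y where iy: "y \<in> K" "x = sg_map q i y" using K(2) by blast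
    obtain z where z: "z \<in> L" "infdist y L = dist y z"
      using infdist_attains_inf[of L y] L compact_imp_closed by blast
    have "sg_map q i z \<in> L" using z L(3) by blast
    then have "infdist x L \<le> dist x (sg_map q i z)" by (rule infdist_le)
    also have "\<dots> = infdist y L / 2" by (simp add: iy(2) z(2) dist_sg_map)
    also have "\<dots> \<le> C / 2 ^ n / 2" using Suc.IH[OF iy(1)] by simp
    finally show ?case by simp
  qed
  then have "infdist x0 L \<le> C / 2 ^ n" for n using x0 by blast
  moreover have "(\<lambda>n. C * (1/2) ^ n) \<longlonglongrightarrow> C * 0"
    by (intro tendsto_intros LIMSEQ_realpow_zero) auto
  ultimately have "infdist x0 L \<le> 0"
    by (intro LIMSEQ_le_const[where X = "\<lambda>n. C * (1/2) ^ n"]) (auto simp: power_divide)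
  then show "x0 \<in> L"
    using in_closed_iff_infdist_zero[of L x0] L compact_imp_closed infdist_nonneg[of x0 L] by auto
qed

text \<open>
  Images of compact sets under the maps are closed, so taking closures commutes with them and the
  closure of the self-similar vertex set is again self-similar. This replaces the implicit
  description of the gasket by one that makes the vertices dense in it.
\<close>

lemma SG_eq_closure: "SG q = closure (all_verts q)"
proof -
  let ?K = "closure (all_verts q)"
  have cK: "compact ?K" using bounded_all_verts by (simp add: compact_closure)
  have img: "sg_map q i ` ?K = closure (sg_map q i ` all_verts q)" for i
  proof
    show "sg_map q i ` ?K \<subseteq> closure (sg_map q i ` all_verts q)"
      by (rule image_closure_subset[OF continuous_sg_map closed_closure closure_subset])
    have "closed (sg_map q i ` ?K)"
      by (intro compact_imp_closed compact_continuous_image continuous_sg_map cK)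
    then show "closure (sg_map q i ` all_verts q) \<subseteq> sg_map q i ` ?K"
      by (intro closure_minimal image_mono closure_subset)
  qed
  have eqK: "?K = (\<Union>i. sg_map q i ` ?K)"
    unfolding img by (subst all_verts_self_similar) (simp add: UNIV_three[of 0] closure_Un)
  have "q 0 \<in> all_verts q"
    unfolding all_verts_def using vertices_subset_verts[of q 0 0] by (rule UN_I[OF UNIV_I])
  then have neK: "?K \<noteq> {}" using closure_subset by blast
  show ?thesis
    unfolding SG_def
  proof (rule the_equality)
    show "?K \<noteq> {} \<and> compact ?K \<and> ?K = (\<Union>i. sg_map q i ` ?K)" using cK eqK neK by blast
    fix L assume L: "L \<noteq> {} \<and> compact L \<and> L = (\<Union>i. sg_map q i ` L)"
    show "L = ?K"
      using compact_self_similar_subset[of L q ?K] compact_self_similar_subset[of ?K q L]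
        L cK eqK neK by blast
  qed
qed

lemma compact_SG: "compact (SG q)"
  using bounded_all_verts by (simp add: SG_eq_closure compact_closure)

lemma verts_subset_SG: "verts q m \<subseteq> SG q"
  unfolding SG_eq_closure using closure_subset[of "all_verts q"] by (auto simp: all_verts_def)

lemma vertex_in_SG [simp]: "q i \<in> SG q"
  using verts_subset_SG[of q 0] by auto

lemma sg_map_in_SG: "x \<in> SG q \<Longrightarrow> sg_map q i x \<in> SG q"
proof -
  have "sg_map q i ` closure (all_verts q) \<subseteq> closure (all_verts q)"
    using all_verts_self_similar[of q] closure_subset[of "all_verts q"]
    by (intro image_closure_subset continuous_sg_map) auto
  then show "x \<in> SG q \<Longrightarrow> sg_map q i x \<in> SG q" by (auto simp: SG_eq_closure)
qed

section \<open>Barycentric coordinates and the overlap of cells\<close>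

locale gasket =
  fixes q :: "3 \<Rightarrow> real^2"
  assumes equilateral: "equilateral q"
begin

abbreviation F :: "3 \<Rightarrow> real^2 \<Rightarrow> real^2" where "F \<equiv> sg_map q"
abbreviation W :: "3 list \<Rightarrow> real^2 \<Rightarrow> real^2" where "W \<equiv> sg_word q"
abbreviation V :: "nat \<Rightarrow> (real^2) set" where "V \<equiv> verts q"
abbreviation K :: "(real^2) set" where "K \<equiv> SG q"

definition side :: real where "side = dist (q 0) (q 1)"

lemma dist_vertices: "i \<noteq> j \<Longrightarrow> dist (q i) (q j) = side"
  using equilateral unfolding equilateral_def side_def by (metis zero_neq_one)

lemma side_pos: "side > 0"
  using equilateral unfolding equilateral_def side_def by (metis zero_neq_one)

text \<open>
  The \<open>i\<close>-th barycentric coordinate, written through squared distances: for another vertex \<open>q\<^sub>k\<close>,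
  the difference \<open>\<bar>x - q\<^sub>k\<bar>\<^sup>2 - \<bar>x - q\<^sub>i\<bar>\<^sup>2\<close> is affine in \<open>x\<close> and vanishes on the perpendicular
  bisector of an edge. As all edges have the same length, the values at the vertices come out as
  \<open>0\<close> and \<open>1\<close>.
\<close>

definition bary :: "3 \<Rightarrow> real^2 \<Rightarrow> real" where
  "bary i x = (1 + (((dist x (q (i + 1)))\<^sup>2 - (dist x (q i))\<^sup>2) +
                   ((dist x (q (i - 1)))\<^sup>2 - (dist x (q i))\<^sup>2)) / side\<^sup>2) / 3"

lemma bary_vertex [simp]: "bary i (q j) = (if i = j then 1 else 0)"
  using three_cases[of j i] side_pos dist_vertices[of i "i + 1"] dist_vertices[of i "i - 1"]
    dist_vertices[of "i + 1" "i - 1"]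
  by (auto simp: bary_def dist_commute)

lemma bary_sum: "(\<Sum>i\<in>UNIV. bary i x) = 1"
proof -
  have [simp]: "(2::3) = -1" "(-2::3) = 1" by simp_all
  show ?thesis using side_pos by (simp add: sum_three[of _ 0] bary_def field_simps)
qed

text \<open>
  The quadratic terms of two squared distances cancel in their difference, which is therefore
  affine in the point.
\<close>

lemma radical_midpoint:
  fixes x y a b :: "real^2"
  shows "(dist ((1/2) *\<^sub>R (x + y)) a)\<^sup>2 - (dist ((1/2) *\<^sub>R (x + y)) b)\<^sup>2
    = (((dist x a)\<^sup>2 - (dist x b)\<^sup>2) + ((dist y a)\<^sup>2 - (dist y b)\<^sup>2)) / 2"
proof -
  have *: "(dist z a)\<^sup>2 - (dist z b)\<^sup>2 = 2 * (z \<bullet> (b - a)) + (a \<bullet> a - b \<bullet> b)" for z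
    by (simp add: dist_norm power2_norm_eq_inner inner_diff inner_commute algebra_simps)
  show ?thesis unfolding * by (simp add: inner_add_left field_simps)
qed

lemma bary_sg_map: "bary k (F i x) = (bary k x + (if k = i then 1 else 0)) / 2"
proof -
  have "bary k (F i x) = (bary k x + bary k (q i)) / 2"
    unfolding bary_def sg_map_def radical_midpoint using side_pos by (simp add: field_simps)
  then show ?thesis by simp
qed

lemma continuous_bary [continuous_intros]: "continuous_on S (bary i)"
  unfolding bary_def using side_pos by (intro continuous_intros) auto

lemma q_inj [simp]: "q i = q j \<longleftrightarrow> i = j"
  using bary_vertex[of i i] bary_vertex[of i j] by (metis zero_neq_one)

text \<open>
  The convex hull of the vertices, in a form which shows that a point is determined by its
  coordinates.
\<close>

definition triangle :: "(real^2) set" where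
  "triangle = {x. (\<forall>i. 0 \<le> bary i x) \<and> x = (\<Sum>i\<in>UNIV. bary i x *\<^sub>R q i)}"

lemma triangle_eqI: "x \<in> triangle \<Longrightarrow> y \<in> triangle \<Longrightarrow> (\<And>i. bary i x = bary i y) \<Longrightarrow> x = y"
  unfolding triangle_def by (metis (mono_tags, lifting) mem_Collect_eq sum.cong)

lemma vertex_in_triangle [simp]: "q i \<in> triangle"
  unfolding triangle_def by (auto simp: if_distrib[of "\<lambda>c. c *\<^sub>R _"] cong: if_cong)

lemma sg_map_in_triangle: "x \<in> triangle \<Longrightarrow> F i x \<in> triangle"
proof -
  assume x: "x \<in> triangle"
  have "(\<Sum>k\<in>UNIV. bary k (F i x) *\<^sub>R q k)
      = (1/2) *\<^sub>R ((\<Sum>k\<in>UNIV. bary k x *\<^sub>R q k) + (\<Sum>k\<in>UNIV. (if k = i then 1 else 0) *\<^sub>R q k))"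
    unfolding sum.distrib[symmetric] scaleR_sum_right
  proof (rule sum.cong[OF refl])
    fix k
    have "((a + b) / 2) *\<^sub>R q k = (1/2) *\<^sub>R (a *\<^sub>R q k + b *\<^sub>R q k)" for a b
      by (simp add: scaleR_add_left[symmetric])
    then show "bary k (F i x) *\<^sub>R q k
        = (1/2) *\<^sub>R (bary k x *\<^sub>R q k + (if k = i then 1 else 0) *\<^sub>R q k)"
      unfolding bary_sg_map .
  qed
  also have "(\<Sum>k\<in>UNIV. (if k = i then 1 else 0) *\<^sub>R q k) = q i"
    by (simp add: if_distrib[of "\<lambda>c. c *\<^sub>R _"] cong: if_cong)
  also have "(\<Sum>k\<in>UNIV. bary k x *\<^sub>R q k) = x" using x by (simp add: triangle_def)
  finally have "(\<Sum>k\<in>UNIV. bary k (F i x) *\<^sub>R q k) = F i x" by (simp only: sg_map_def)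
  then show ?thesis using x by (auto simp: triangle_def bary_sg_map)
qed

lemma sg_word_in_triangle: "x \<in> triangle \<Longrightarrow> W w x \<in> triangle"
  by (induction w) (auto intro: sg_map_in_triangle)

lemma SG_subset_triangle: "K \<subseteq> triangle"
proof -
  have "closed triangle"
    unfolding triangle_def Collect_conj_eq Collect_all_eq
    by (intro closed_Int closed_INT ballI closed_Collect_le closed_Collect_eq continuous_intros)
  moreover have "V m \<subseteq> triangle" for m
    by (auto elim!: vertsE intro: sg_word_in_triangle)
  ultimately show ?thesis
    unfolding SG_eq_closure all_verts_def by (intro closure_minimal) auto
qed

text \<open>
  On the image of \<open>F j\<close> the \<open>j\<close>-th coordinate is at least \<open>1/2\<close>, while \<open>F i\<close> halves it; so the
  \<open>j\<close>-th coordinate of \<open>x\<close> is at least \<open>1\<close>.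
\<close>

lemma sg_map_overlap:
  assumes "x \<in> triangle" "y \<in> triangle" "F i x = F j y" "i \<noteq> j"
  shows "x = q j"
proof -
  have nn: "0 \<le> bary k x" "0 \<le> bary k y" for k using assms by (auto simp: triangle_def)
  have "bary j (F i x) = bary j (F j y)" using assms by simp
  then have ge: "bary j x \<ge> 1" using nn(2)[of j] assms(4) by (simp add: bary_sg_map)
  have s: "bary j x + bary (j + 1) x + bary (j - 1) x = 1"
    using bary_sum[of x] sum_three[of "\<lambda>i. bary i x" j] by simp
  show ?thesis
  proof (rule triangle_eqI[OF assms(1) vertex_in_triangle])
    fix k show "bary k x = bary k (q j)"
      using three_cases[of k j] ge s nn(1)[of "j + 1"] nn(1)[of "j - 1"] by auto
  qed
qed

text \<open>
  Peel off the letters of \<open>w\<close>: if the vertex is reached through a different first letter, the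
  overlap lemma identifies the rest of the point as a corner.
\<close>

lemma cell_vertex:
  assumes "t \<in> triangle" "W w t \<in> V (length w)"
  shows "t \<in> range q"
  using assms(2)
proof (induction w)
  case Nil
  then show ?case by simp
next
  case (Cons i w)
  then obtain j y where y: "y \<in> V (length w)" "F i (W w t) = F j y" by auto
  have yT: "y \<in> triangle" using y verts_subset_SG SG_subset_triangle by blast
  have wT: "W w t \<in> triangle" using assms(1) by (rule sg_word_in_triangle)
  have "W w t \<in> V (length w)"
  proof (cases "i = j")
    case True
    then show ?thesis using y by simp
  next
    case False
    then have "W w t = q j" using sg_map_overlap wT yT y by blast
    then show ?thesis using vertices_subset_verts by metis
  qed
  then show ?case by (rule Cons.IH)
qed

text \<open>
  At the first letter where the two words differ, the images overlap in a single midpoint, which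
  is a vertex of the level after that letter.
\<close>

lemma cells_meet:
  assumes "length v = length w" "v \<noteq> w"
  shows "\<exists>p\<in>V (length w). \<forall>s\<in>triangle. \<forall>t\<in>triangle. W v s = W w t \<longrightarrow> W w t = p"
  using assms
proof (induction v w rule: list_induct2)
  case Nil
  then show ?case by simp
next
  case (Cons i v j w)
  show ?case
  proof (cases "i = j")
    case True
    then obtain p where p: "p \<in> V (length w)"
        "\<forall>s\<in>triangle. \<forall>t\<in>triangle. W v s = W w t \<longrightarrow> W w t = p"
      using Cons by auto
    show ?thesis
      by (rule bexI[of _ "F j p"]) (use p True in auto)
  next
    case False
    have "F j (q i) \<in> V (length (j # w))" using vertices_subset_verts[of q i "length w"] by auto
    moreover have "W (j # w) t = F j (q i)"
      if "s \<in> triangle" "t \<in> triangle" "W (i # v) s = W (j # w) t" for s t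
      using sg_map_overlap[of "W w t" "W v s" j i] that False by (auto simp: sg_word_in_triangle)
    ultimately show ?thesis by blast
  qed
qed

section \<open>The graph Laplacian as a sum over incident cells\<close>

definition addr :: "nat \<Rightarrow> real^2 \<Rightarrow> (3 list \<times> 3) set" where
  "addr m x = {(w, i). length w = m \<and> W w (q i) = x}"

lemma mem_addr [simp]: "(w, i) \<in> addr m x \<longleftrightarrow> length w = m \<and> W w (q i) = x"
  by (simp add: addr_def)

lemma finite_addr [simp]: "finite (addr m x)"
proof (rule finite_subset)
  show "addr m x \<subseteq> {w. set w \<subseteq> UNIV \<and> length w = m} \<times> UNIV" by auto
  show "finite ({w. set w \<subseteq> (UNIV::3 set) \<and> length w = m} \<times> (UNIV::3 set))"
    by (intro finite_cartesian_product finite_lists_length_eq) auto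
qed

text \<open>
  The share of one incident cell in the graph Laplacian at its corner.
\<close>

definition corner :: "(real^2 \<Rightarrow> real) \<Rightarrow> 3 list \<Rightarrow> 3 \<Rightarrow> real" where
  "corner u w i = (\<Sum>l\<in>UNIV. u (W w (q l)) - u (W w (q i)))"

definition lap :: "nat \<Rightarrow> (real^2 \<Rightarrow> real) \<Rightarrow> real^2 \<Rightarrow> real" where
  "lap m u x = (\<Sum>y | adjacent q m x y. u y - u x)"

lemma discrete_laplacian_eq: "discrete_laplacian q m u x = 3/2 * 5^m * lap m u x"
  by (simp add: discrete_laplacian_def lap_def)

text \<open>
  The neighbours of \<open>x\<close> are the other corners of the cells at \<open>x\<close>; none is reached from two cells,
  because distinct cells share at most one point, and that one is \<open>x\<close>.
\<close>

lemma neighbours_bij: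
  "bij_betw (\<lambda>((w, i), l). W w (q l)) (SIGMA p:addr m x. UNIV - {snd p}) {y. adjacent q m x y}"
  unfolding bij_betw_def
proof
  show "inj_on (\<lambda>((w, i), l). W w (q l)) (SIGMA p:addr m x. UNIV - {snd p})"
  proof (rule inj_onI)
    fix a b
    assume ab: "a \<in> (SIGMA p:addr m x. UNIV - {snd p})" "b \<in> (SIGMA p:addr m x. UNIV - {snd p})"
      "(\<lambda>((w, i), l). W w (q l)) a = (\<lambda>((w, i), l). W w (q l)) b"
    obtain w i l v j k where abeq: "a = ((w, i), l)" "b = ((v, j), k)"
      by (metis prod.collapse)
    have h: "l \<noteq> i" "W w (q l) = W v (q k)" "length v = length w" "W v (q j) = W w (q i)"
      using ab unfolding abeq by auto
    have "v = w"
    proof (rule ccontr)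
      assume "v \<noteq> w"
      then obtain p where p: "\<forall>s\<in>triangle. \<forall>t\<in>triangle. W v s = W w t \<longrightarrow> W w t = p"
        using cells_meet[OF h(3)] by blast
      have "W w (q l) = p" "W w (q i) = p"
        using p h(2,4) vertex_in_triangle by metis+
      then show False using h(1) by (metis q_inj sg_word_inj)
    qed
    then show "a = b" using h by (simp add: abeq)
  qed
  show "(\<lambda>((w, i), l). W w (q l)) ` (SIGMA p:addr m x. UNIV - {snd p}) = {y. adjacent q m x y}"
    (is "?L = ?R")
  proof
    show "?L \<subseteq> ?R"
      by (auto simp: adjacent_def cell_def sg_word_in_verts intro!: exI imageI)
    show "?R \<subseteq> ?L"
    proof
      fix y assume "y \<in> ?R"
      then obtain w s t where w: "length w = m" "x = W w s" "y = W w t" "s \<in> K" "t \<in> K" "x \<noteq> y"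
          "x \<in> V m" "y \<in> V m"
        by (auto simp: adjacent_def cell_def)
      then obtain i l where "s = q i" "t = q l"
        using cell_vertex[of s w] cell_vertex[of t w] SG_subset_triangle by blast
      then show "y \<in> ?L" using w
        by (intro image_eqI[of _ _ "((w, i), l)"]) auto
    qed
  qed
qed

lemma lap_eq_corners: "lap m u x = (\<Sum>(w, i)\<in>addr m x. corner u w i)"
proof -
  have "lap m u x = (\<Sum>((w, i), l)\<in>(SIGMA p:addr m x. UNIV - {snd p}). u (W w (q l)) - u x)"
    unfolding lap_def sum.reindex_bij_betw[OF neighbours_bij, symmetric]
    by (simp add: case_prod_beta)
  also have "\<dots> = (\<Sum>p\<in>addr m x. \<Sum>l\<in>UNIV - {snd p}. u (W (fst p) (q l)) - u x)"
    by (subst sum.Sigma) (auto simp: case_prod_beta)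
  also have "\<dots> = (\<Sum>p\<in>addr m x. corner u (fst p) (snd p))"
  proof (rule sum.cong[OF refl])
    fix p assume "p \<in> addr m x"
    then have "x = W (fst p) (q (snd p))" by (cases p) auto
    then show "(\<Sum>l\<in>UNIV - {snd p}. u (W (fst p) (q l)) - u x) = corner u (fst p) (snd p)"
      by (simp add: corner_def sum_diff1)
  qed
  finally show ?thesis by (simp add: case_prod_beta)
qed

section \<open>Harmonic extension and bounds for the graph Laplacian\<close>

text \<open>
  Indexed by the opposite vertex.
\<close>

definition mid :: "3 \<Rightarrow> real^2" where
  "mid k = F (k + 1) (q (k - 1))"

lemma mid_alt: "F (k - 1) (q (k + 1)) = mid k"
  by (simp add: mid_def sg_map_swap)

lemma mid_in_triangle [simp]: "mid k \<in> triangle"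
  by (simp add: mid_def sg_map_in_triangle)

lemma bary_mid: "bary i (mid k) = (if i = k then 0 else 1/2)"
  using three_cases[of i k] by (auto simp: mid_def bary_sg_map)

lemma mid_not_vertex: "mid k \<notin> range q"
proof
  assume "mid k \<in> range q"
  then obtain i where "mid k = q i" by auto
  then have "bary (k + 1) (mid k) = bary (k + 1) (q i)" by simp
  then show False by (simp add: bary_mid split: if_splits)
qed

lemma sg_map_vertex_eq_mid:
  assumes "F a (q b) = mid k"
  shows "(a = k + 1 \<and> b = k - 1) \<or> (a = k - 1 \<and> b = k + 1)"
proof -
  have "bary j (F a (q b)) = bary j (mid k)" for j using assms by simp
  from this[of k] this[of "k + 1"] show ?thesis
    using three_cases[of a k] three_cases[of b k]
    by (auto simp: bary_mid bary_sg_map split: if_splits)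
qed

lemma sg_map_vertex_cases:
  assumes "i \<noteq> j"
  obtains k where "F i (q j) = mid k"
proof -
  from three_cases[of j i] assms have "j = i + 1 \<or> j = i - 1" by auto
  then show ?thesis
  proof
    assume "j = i + 1"
    then show ?thesis using that[of "i - 1"] by (simp add: mid_def)
  next
    assume "j = i - 1"
    then show ?thesis using that[of "i + 1"] mid_alt[of "i + 1"] by simp
  qed
qed

text \<open>
  Refinement does not change the number of cells at an old vertex: each is replaced by its subcell
  at the same corner.
\<close>

lemma addr_old:
  assumes "x \<in> V m"
  shows "addr (Suc m) x = (\<lambda>(w, i). (w @ [i], i)) ` addr m x"
proof
  show "(\<lambda>(w, i). (w @ [i], i)) ` addr m x \<subseteq> addr (Suc m) x"
    by (auto simp: sg_word_append)
  show "addr (Suc m) x \<subseteq> (\<lambda>(w, i). (w @ [i], i)) ` addr m x"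
  proof
    fix p assume p: "p \<in> addr (Suc m) x"
    then obtain v l where vl: "p = (v, l)" "length v = Suc m" "W v (q l) = x" by (cases p) auto
    then obtain w i where w: "v = w @ [i]" by (cases v rule: rev_exhaust) auto
    have x: "W w (F i (q l)) = x" "length w = m" using vl w by (auto simp: sg_word_append)
    have "F i (q l) \<in> range q"
      using cell_vertex[of "F i (q l)" w] x assms by (simp add: sg_map_in_triangle)
    then have "i = l" using sg_map_vertex_cases[of i l] mid_not_vertex by metis
    then show "p \<in> (\<lambda>(w, i). (w @ [i], i)) ` addr m x"
      using vl w x by (intro image_eqI[of _ _ "(w, l)"]) auto
  qed
qed

lemma word_mid_not_vert: "W w (mid k) \<notin> V (length w)"
  using cell_vertex[of "mid k" w] mid_not_vertex by auto

lemma word_mid_in_verts: "W w (mid k) \<in> V (Suc (length w))"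
  using sg_word_in_verts[of q "w @ [k + 1]" "k - 1"] by (simp add: sg_word_append mid_def)

lemma word_mid_interior: "W w (mid k) \<in> V (Suc (length w)) - V 0"
  using word_mid_not_vert[of w k] word_mid_in_verts[of w k] verts_mono[of 0 "length w" q] by blast

lemma addr_new:
  "addr (Suc (length w)) (W w (mid k)) = {(w @ [k + 1], k - 1), (w @ [k - 1], k + 1)}"
proof
  show "{(w @ [k + 1], k - 1), (w @ [k - 1], k + 1)} \<subseteq> addr (Suc (length w)) (W w (mid k))"
    by (auto simp: sg_word_append mid_alt mid_def[symmetric])
  show "addr (Suc (length w)) (W w (mid k)) \<subseteq> {(w @ [k + 1], k - 1), (w @ [k - 1], k + 1)}"
  proof
    fix p assume "p \<in> addr (Suc (length w)) (W w (mid k))"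
    then obtain y l where yl: "p = (y, l)" "length y = Suc (length w)" "W y (q l) = W w (mid k)"
      by (cases p) auto
    then obtain v i where v: "y = v @ [i]" by (cases y rule: rev_exhaust) auto
    have eq: "W v (F i (q l)) = W w (mid k)" "length v = length w"
      using yl v by (auto simp: sg_word_append)
    have "v = w"
    proof (rule ccontr)
      assume "v \<noteq> w"
      with cells_meet[OF eq(2)] obtain p where "p \<in> V (length w)"
        "\<forall>s\<in>triangle. \<forall>t\<in>triangle. W v s = W w t \<longrightarrow> W w t = p" by blast
      then have "W w (mid k) \<in> V (length w)" using eq(1)
        by (metis mid_in_triangle sg_map_in_triangle vertex_in_triangle)
      then show False using word_mid_not_vert by blast
    qed
    then show "p \<in> {(w @ [k + 1], k - 1), (w @ [k - 1], k + 1)}"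
      using eq sg_map_vertex_eq_mid[of i l k] yl v by auto
  qed
qed

lemma card_addr_le:
  assumes "x \<notin> V 0"
  shows "card (addr m x) \<le> 2"
proof (induction m)
  case 0
  have "addr 0 x = {}" using assms by (auto simp: addr_def)
  then show ?case by simp
next
  case (Suc m)
  show ?case
  proof (cases "x \<in> V m")
    case True
    have "card (addr (Suc m) x) \<le> card (addr m x)"
      unfolding addr_old[OF True] by (rule card_image_le) simp
    then show ?thesis using Suc.IH by simp
  next
    case False
    show ?thesis
    proof (cases "addr (Suc m) x = {}")
      case True
      then show ?thesis by simp
    next
      case nonempty: False
      then obtain p where "p \<in> addr (Suc m) x" by blast
      then obtain v l where vl: "length v = Suc m" "W v (q l) = x" by (cases p) auto
      then obtain w i where w: "v = w @ [i]" by (cases v rule: rev_exhaust) auto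
      have x: "W w (F i (q l)) = x" "length w = m" using vl w by (auto simp: sg_word_append)
      have "i \<noteq> l" using x False sg_word_in_verts[of q w l] by auto
      then obtain k where "F i (q l) = mid k" by (rule sg_map_vertex_cases)
      then have "addr (Suc m) x = {(w @ [k + 1], k - 1), (w @ [k - 1], k + 1)}"
        using addr_new[of w k] x by simp
      then show ?thesis by (simp add: card_insert_if)
    qed
  qed
qed

lemma corner_eq:
  "corner u w i = u (W w (q (i + 1))) + u (W w (q (i - 1))) - 2 * u (W w (q i))"
  by (simp add: corner_def sum_three[of _ i])

lemma lap_mid:
  "lap (Suc (length w)) u (W w (mid k)) =
    u (W w (q (k + 1))) + u (W w (q (k - 1))) + u (W w (mid (k + 1))) + u (W w (mid (k - 1)))
      - 4 * u (W w (mid k))"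
proof -
  have m: "F (k + 1) (q (k - 1)) = mid k" "F (k - 1) (q (k + 1)) = mid k"
    "F (k + 1) (q k) = mid (k - 1)" "F (k - 1) (q k) = mid (k + 1)"
    using mid_alt[of k] mid_alt[of "k - 1"] mid_alt[of "k + 1"]
    by (auto simp: mid_def sg_map_swap)
  have "(w @ [k + 1], k - 1) \<noteq> (w @ [k - 1], k + 1)" by simp
  then have "lap (Suc (length w)) u (W w (mid k))
      = corner u (w @ [k + 1]) (k - 1) + corner u (w @ [k - 1]) (k + 1)"
    unfolding lap_eq_corners addr_new by simp
  then show ?thesis by (simp add: corner_eq sg_word_append m)
qed

text \<open>
  The three equations \<open>lap_mid\<close> form a linear system for the values at the midpoints; this is its
  solution. For \<open>d = 0\<close> it is the rule by which harmonic functions extend from the corners of a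
  cell to the midpoints with weights \<open>2/5, 2/5, 1/5\<close>. The correction terms all carry the same
  sign, so bounds on \<open>d\<close> add up without loss.
\<close>

lemma mid_value:
  fixes u w
  defines "a \<equiv> \<lambda>k. u (W w (q k))" and "d \<equiv> \<lambda>k. lap (Suc (length w)) u (W w (mid k))"
  shows "u (W w (mid k)) = (2 * a (k + 1) + 2 * a (k - 1) + a k) / 5
    - (d (k + 1) + d (k - 1) + 3 * d k) / 10"
  using lap_mid[of w u k] lap_mid[of w u "k + 1"] lap_mid[of w u "k - 1"]
  unfolding a_def d_def by (simp only: three_shift add_diff_cancel_right' diff_add_cancel) argo

text \<open>
  Eliminates the midpoint values from the contribution of one cell. The factor \<open>5/3\<close> is the
  renormalisation factor of the energy of the gasket.
\<close>

lemma corner_refine: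
  fixes u w
  defines "d \<equiv> \<lambda>k. lap (Suc (length w)) u (W w (mid k))"
  shows "corner u w i
    = 5/3 * (corner u (w @ [i]) i + (d i + 2 * d (i + 1) + 2 * d (i - 1)) / 5)"
proof -
  have m: "F i (q (i + 1)) = mid (i - 1)" "F i (q (i - 1)) = mid (i + 1)"
    using mid_alt[of "i + 1"] by (auto simp: mid_def)
  show ?thesis
    using lap_mid[of w u i] lap_mid[of w u "i + 1"] lap_mid[of w u "i - 1"]
    unfolding d_def corner_eq
    by (simp only: sg_word_append sg_word.simps id_apply comp_apply m sg_map_fixpoint
        three_shift add_diff_cancel_right' diff_add_cancel) argo
qed

lemma lap_refine:
  assumes "x \<in> V m"
  shows "lap m u x = 5/3 * (lap (Suc m) u x + (\<Sum>(w, i)\<in>addr m x.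
    (lap (Suc m) u (W w (mid i)) + 2 * lap (Suc m) u (W w (mid (i + 1)))
      + 2 * lap (Suc m) u (W w (mid (i - 1)))) / 5))"
proof -
  let ?e = "\<lambda>w i. (lap (Suc m) u (W w (mid i)) + 2 * lap (Suc m) u (W w (mid (i + 1)))
      + 2 * lap (Suc m) u (W w (mid (i - 1)))) / 5"
  have "lap (Suc m) u x = (\<Sum>(w, i)\<in>addr m x. corner u (w @ [i]) i)"
    unfolding lap_eq_corners addr_old[OF assms]
    by (subst sum.reindex) (auto simp: inj_on_def case_prod_beta)
  moreover have "lap m u x = (\<Sum>(w, i)\<in>addr m x. 5/3 * (corner u (w @ [i]) i + ?e w i))"
    unfolding lap_eq_corners[of m]
  proof (rule sum.cong[OF refl])
    fix p assume "p \<in> addr m x"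
    then show "(case p of (w, i) \<Rightarrow> corner u w i)
        = (case p of (w, i) \<Rightarrow> 5/3 * (corner u (w @ [i]) i + ?e w i))"
      using corner_refine[of u "fst p" "snd p"] by (cases p) simp
  qed
  ultimately show ?thesis
    by (simp only: case_prod_beta' sum.distrib sum_distrib_left[symmetric])
qed

text \<open>
  At most two cells meet at \<open>x\<close>, and each contributes an average of values of the finer Laplacian
  with total weight \<open>1\<close>: the factor is \<open>5/3 * (1 + 2) = 5\<close>.
\<close>

lemma lap_bound_step:
  assumes b: "\<And>x. x \<in> V (Suc m) - V 0 \<Longrightarrow> \<bar>lap (Suc m) u x\<bar> \<le> \<delta>"
    and x: "x \<in> V m - V 0"
  shows "\<bar>lap m u x\<bar> \<le> 5 * \<delta>"
proof -
  let ?e = "\<lambda>w i. (lap (Suc m) u (W w (mid i)) + 2 * lap (Suc m) u (W w (mid (i + 1)))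
      + 2 * lap (Suc m) u (W w (mid (i - 1)))) / 5"
  have x': "\<bar>lap (Suc m) u x\<bar> \<le> \<delta>" using b[of x] x verts_Suc_mono by blast
  have e: "\<bar>?e w i\<bar> \<le> \<delta>" if "length w = m" for w i
    using b[OF word_mid_interior[of w i, unfolded that]]
      b[OF word_mid_interior[of w "i + 1", unfolded that]]
      b[OF word_mid_interior[of w "i - 1", unfolded that]]
    by (auto simp: abs_le_iff)
  define S where "S = (\<Sum>(w, i)\<in>addr m x. ?e w i)"
  have "\<bar>S\<bar> \<le> (\<Sum>p\<in>addr m x. \<delta>)"
    unfolding S_def by (rule order_trans[OF sum_abs sum_mono]) (use e in auto)
  also have "\<dots> = real (card (addr m x)) * \<delta>" by simp
  also have "\<dots> \<le> 2 * \<delta>"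
    using card_addr_le[of x m] x x' by (intro mult_right_mono) auto
  finally have "\<bar>S\<bar> \<le> 2 * \<delta>" .
  moreover have "lap m u x = 5/3 * (lap (Suc m) u x + S)"
    unfolding S_def by (rule lap_refine[OF DiffD1[OF x]])
  ultimately show ?thesis using x' by (auto simp: abs_le_iff)
qed

text \<open>
  The definition of the Laplacian controls only high levels \<open>n\<close>, with an error. Descending from
  \<open>n\<close> to \<open>m\<close> costs a factor \<open>5\<close> per level, which is exactly the loss that the normalisation \<open>5 ^
  m\<close> absorbs; hence the error can be sent to \<open>0\<close> while \<open>m\<close> stays fixed.
\<close>

lemma lap_bound:
  assumes u: "has_laplacian q u f" and f: "\<And>x. x \<in> K \<Longrightarrow> \<bar>f x\<bar> \<le> B"
    and x: "x \<in> V m - V 0"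
  shows "\<bar>lap m u x\<bar> \<le> 2/3 * B / 5 ^ m"
proof -
  have "3/2 * 5 ^ m * \<bar>lap m u x\<bar> \<le> B + e" if "e > 0" for e
  proof -
    have "\<forall>\<^sub>F n in sequentially. \<forall>x\<in>V n - V 0. \<bar>discrete_laplacian q n u x - f x\<bar> < e"
      using u that by (simp add: has_laplacian_def)
    then obtain n where n: "n \<ge> m" "\<forall>x\<in>V n - V 0. \<bar>discrete_laplacian q n u x - f x\<bar> < e"
      unfolding eventually_sequentially by (metis max.cobounded1 max.cobounded2)
    have "\<forall>x\<in>V m - V 0. \<bar>lap m u x\<bar> \<le> 2/3 * (B + e) / 5 ^ m"
      using n(1)
    proof (induction m rule: inc_induct)
      case base
      show ?case
      proof
        fix x assume x: "x \<in> V n - V 0"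
        then have "\<bar>f x\<bar> \<le> B" using f verts_subset_SG by blast
        moreover have "\<bar>3/2 * 5 ^ n * lap n u x - f x\<bar> < e"
          using n(2) x unfolding discrete_laplacian_eq by blast
        ultimately have "\<bar>3/2 * 5 ^ n * lap n u x\<bar> \<le> B + e"
          using abs_triangle_ineq2[of "3/2 * 5 ^ n * lap n u x" "f x"] by linarith
        then show "\<bar>lap n u x\<bar> \<le> 2/3 * (B + e) / 5 ^ n"
          by (simp add: abs_mult field_simps)
      qed
    next
      case (step k)
      show ?case
      proof
        fix x assume "x \<in> V k - V 0"
        then have "\<bar>lap k u x\<bar> \<le> 5 * (2/3 * (B + e) / 5 ^ Suc k)"
          using step.IH by (intro lap_bound_step) auto
        moreover have "5 * (2/3 * (B + e) / 5 ^ Suc k) = 2/3 * (B + e) / 5 ^ k" by (simp add: field_simps)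
        ultimately show "\<bar>lap k u x\<bar> \<le> 2/3 * (B + e) / 5 ^ k" by (simp only:)
      qed
    qed
    then show ?thesis using x by (auto simp: field_simps)
  qed
  then have "3/2 * 5 ^ m * \<bar>lap m u x\<bar> \<le> B" by (rule field_le_epsilon)
  then show ?thesis by (simp add: field_simps)
qed

section \<open>Restriction to cells and linearity\<close>

lemma sg_map_interior:
  assumes "x \<in> V m - V 0"
  shows "F i x \<in> V (Suc m) - V 0"
proof -
  have xT: "x \<in> triangle" using assms verts_subset_SG SG_subset_triangle by blast
  have "F i x \<noteq> q j" for j
  proof
    assume "F i x = q j"
    then have *: "F i x = F j (q j)" by simp
    show False
    proof (cases "i = j")
      case True
      then have "x = q j" using * by (simp only: sg_map_inj)
      then show False using assms by auto
    next
      case False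
      then show False using sg_map_overlap[OF xT vertex_in_triangle *] assms by auto
    qed
  qed
  then show ?thesis using assms by auto
qed

text \<open>
  Away from the corners, the cells at \<open>F i x\<close> all lie in the cell \<open>F i\<close>, as \<open>x\<close> would otherwise be
  a corner by the overlap lemma.
\<close>

lemma addr_sg_map:
  assumes "x \<in> V m - V 0"
  shows "addr (Suc n) (F i x) = (\<lambda>(w, l). (i # w, l)) ` addr n x"
proof
  show "(\<lambda>(w, l). (i # w, l)) ` addr n x \<subseteq> addr (Suc n) (F i x)" by auto
  show "addr (Suc n) (F i x) \<subseteq> (\<lambda>(w, l). (i # w, l)) ` addr n x"
  proof
    fix p assume "p \<in> addr (Suc n) (F i x)"
    then obtain j w l where p: "p = (j # w, l)" "length w = n" "F i x = F j (W w (q l))"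
      by (cases p) (auto simp: length_Suc_conv)
    have xT: "x \<in> triangle" using assms verts_subset_SG SG_subset_triangle by blast
    have "i = j"
    proof (rule ccontr)
      assume "i \<noteq> j"
      then have "x = q j"
        using sg_map_overlap[OF xT _ p(3)] by (simp add: sg_word_in_triangle)
      then show False using assms by auto
    qed
    then show "p \<in> (\<lambda>(w, l). (i # w, l)) ` addr n x" using p by force
  qed
qed

lemma lap_sg_map:
  assumes "x \<in> V m - V 0"
  shows "lap (Suc n) u (F i x) = lap n (\<lambda>x. u (F i x)) x"
  unfolding lap_eq_corners addr_sg_map[OF assms]
  by (subst sum.reindex) (auto simp: inj_on_def case_prod_beta corner_def)

text \<open>
  Level \<open>m\<close> for \<open>u \<circ> F i\<close> is level \<open>m + 1\<close> for \<open>u\<close>, where the normalising factor is five times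
  larger.
\<close>

lemma has_laplacian_sg_map:
  assumes u: "has_laplacian q u f"
  shows "has_laplacian q (\<lambda>x. u (F i x)) (\<lambda>x. f (F i x) / 5)"
  unfolding has_laplacian_def
proof (intro conjI allI impI)
  have "continuous_on K (\<lambda>x. g (F i x))" if "continuous_on K g" for g :: "real^2 \<Rightarrow> real"
    by (rule continuous_on_compose2[OF that continuous_sg_map]) (auto intro: sg_map_in_SG)
  then show "continuous_on K (\<lambda>x. u (F i x))" "continuous_on K (\<lambda>x. f (F i x) / 5)"
    using u by (auto simp: has_laplacian_def intro!: continuous_intros)
  fix e :: real assume "e > 0"
  then have "\<forall>\<^sub>F m in sequentially. \<forall>x\<in>V m - V 0. \<bar>discrete_laplacian q m u x - f x\<bar> < 5 * e"
    using u unfolding has_laplacian_def by (meson mult_pos_pos zero_less_numeral)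
  then have "\<forall>\<^sub>F m in sequentially. \<forall>x\<in>V (Suc m) - V 0.
      \<bar>discrete_laplacian q (Suc m) u x - f x\<bar> < 5 * e"
    by (subst eventually_sequentially_Suc)
  then show "\<forall>\<^sub>F m in sequentially. \<forall>x\<in>V m - V 0.
      \<bar>discrete_laplacian q m (\<lambda>x. u (F i x)) x - f (F i x) / 5\<bar> < e"
  proof (rule eventually_mono, intro ballI)
    fix m x
    assume *: "\<forall>x\<in>V (Suc m) - V 0. \<bar>discrete_laplacian q (Suc m) u x - f x\<bar> < 5 * e"
      and x: "x \<in> V m - V 0"
    have "discrete_laplacian q (Suc m) u (F i x) = 5 * discrete_laplacian q m (\<lambda>x. u (F i x)) x"
      by (simp add: discrete_laplacian_eq lap_sg_map[OF x])
    with *[rule_format, OF sg_map_interior[OF x, of i]]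
    show "\<bar>discrete_laplacian q m (\<lambda>x. u (F i x)) x - f (F i x) / 5\<bar> < e" by (simp add: abs_less_iff)
  qed
qed

lemma lap_lincomb: "lap m (\<lambda>x. a * u x + b * v x) x = a * lap m u x + b * lap m v x"
  unfolding lap_def by (simp add: sum_distrib_left sum.distrib[symmetric] algebra_simps)

lemma has_laplacian_lincomb:
  assumes "has_laplacian q u f" "has_laplacian q v g"
  shows "has_laplacian q (\<lambda>x. a * u x + b * v x) (\<lambda>x. a * f x + b * g x)"
  unfolding has_laplacian_def
proof (intro conjI allI impI)
  show "continuous_on K (\<lambda>x. a * u x + b * v x)" "continuous_on K (\<lambda>x. a * f x + b * g x)"
    using assms by (auto simp: has_laplacian_def intro!: continuous_intros)
  fix e :: real assume e: "e > 0"
  define c where "c = \<bar>a\<bar> + \<bar>b\<bar> + 1"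
  have c: "c > 0" by (simp add: c_def)
  then have "\<forall>\<^sub>F m in sequentially. \<forall>x\<in>V m - V 0. \<bar>discrete_laplacian q m u x - f x\<bar> < e / c"
    "\<forall>\<^sub>F m in sequentially. \<forall>x\<in>V m - V 0. \<bar>discrete_laplacian q m v x - g x\<bar> < e / c"
    using assms e by (auto simp: has_laplacian_def)
  then show "\<forall>\<^sub>F m in sequentially. \<forall>x\<in>V m - V 0.
      \<bar>discrete_laplacian q m (\<lambda>x. a * u x + b * v x) x - (a * f x + b * g x)\<bar> < e"
  proof eventually_elim
    case (elim m)
    show ?case
    proof
      fix x assume x: "x \<in> V m - V 0"
      let ?A = "discrete_laplacian q m u x - f x" and ?B = "discrete_laplacian q m v x - g x"
      have "discrete_laplacian q m (\<lambda>x. a * u x + b * v x) x - (a * f x + b * g x)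
          = a * ?A + b * ?B"
        by (simp add: discrete_laplacian_eq lap_lincomb algebra_simps)
      also have "\<bar>\<dots>\<bar> \<le> \<bar>a\<bar> * \<bar>?A\<bar> + \<bar>b\<bar> * \<bar>?B\<bar>"
        by (rule order_trans[OF abs_triangle_ineq]) (simp add: abs_mult)
      also have "\<dots> \<le> \<bar>a\<bar> * (e / c) + \<bar>b\<bar> * (e / c)"
        using elim x by (intro add_mono mult_left_mono) (auto intro: less_imp_le)
      also have "\<dots> < c * (e / c)"
        using c e unfolding c_def by (simp add: distrib_right[symmetric] divide_strict_right_mono
            mult_strict_right_mono del: times_divide_eq_right)
      also have "\<dots> = e" using c by simp
      finally show "\<bar>discrete_laplacian q m (\<lambda>x. a * u x + b * v x) x - (a * f x + b * g x)\<bar> < e" .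
    qed
  qed
qed

lemma has_laplacian_const: "has_laplacian q (\<lambda>_. c) (\<lambda>_. 0)"
  by (simp add: has_laplacian_def discrete_laplacian_def)

lemma has_laplacian_diff:
  "has_laplacian q u f \<Longrightarrow> has_laplacian q v g \<Longrightarrow> has_laplacian q (\<lambda>x. u x - v x) (\<lambda>x. f x - g x)"
  using has_laplacian_lincomb[of u f v g 1 "-1"] by simp

lemma has_laplacian_cmult:
  "has_laplacian q u f \<Longrightarrow> has_laplacian q (\<lambda>x. c * u x) (\<lambda>x. c * f x)"
  using has_laplacian_lincomb[of u f u f c 0] by simp

lemma has_laplacian_sum:
  assumes "finite A" "\<And>k. k \<in> A \<Longrightarrow> has_laplacian q (u k) (f k)"
  shows "has_laplacian q (\<lambda>x. \<Sum>k\<in>A. u k x) (\<lambda>x. \<Sum>k\<in>A. f k x)"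
  using assms
proof (induction A rule: finite_induct)
  case empty
  then show ?case using has_laplacian_const[of 0] by simp
next
  case (insert k A)
  then show ?case
    using has_laplacian_lincomb[of "u k" "f k" "\<lambda>x. \<Sum>k\<in>A. u k x" "\<lambda>x. \<Sum>k\<in>A. f k x" 1 1] by simp
qed

section \<open>Maximum principle and decay\<close>

text \<open>
  Absolute values in \<open>mid_value\<close>: the three corrections add up to at most \<open>(5/10) * (2/3) * B / 5
  = B / 15\<close>.
\<close>

lemma mid_bound:
  assumes u: "has_laplacian q u f" and f: "\<And>x. x \<in> K \<Longrightarrow> \<bar>f x\<bar> \<le> B"
    and "\<bar>u (q (k + 1))\<bar> \<le> a" "\<bar>u (q (k - 1))\<bar> \<le> b" "\<bar>u (q k)\<bar> \<le> c"
  shows "\<bar>u (mid k)\<bar> \<le> (2 * a + 2 * b + c) / 5 + B / 15"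
proof -
  have "\<bar>lap (Suc 0) u (mid j)\<bar> \<le> 2/3 * B / 5" for j
    using lap_bound[OF u f, of "mid j" "Suc 0"] word_mid_interior[of "[]" j] by simp
  note d = this[of k] this[of "k + 1"] this[of "k - 1"]
  have "u (mid k) = (2 * u (q (k + 1)) + 2 * u (q (k - 1)) + u (q k)) / 5
      - (lap (Suc 0) u (mid (k + 1)) + lap (Suc 0) u (mid (k - 1)) + 3 * lap (Suc 0) u (mid k)) / 10"
    using mid_value[of u "[]" k] by simp
  with d assms(3-5) show ?thesis
    unfolding abs_le_iff by argo
qed

text \<open>
  Passing to a subcell costs \<open>B / 15\<close> and divides \<open>B\<close> by \<open>5\<close>; the constant is \<open>1/12 = (1/15) * (1
  + 1/5 + 1/25 + \<dots>)\<close>.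
\<close>

lemma bound_on_verts:
  assumes "has_laplacian q u f" and "\<And>x. x \<in> K \<Longrightarrow> \<bar>f x\<bar> \<le> B"
    and "\<And>i. \<bar>u (q i)\<bar> \<le> M" and "x \<in> V m"
  shows "\<bar>u x\<bar> \<le> M + B / 12"
  using assms
proof (induction m arbitrary: u f B M x)
  case 0
  have B: "0 \<le> B" using 0(2)[of "q 0"] by simp
  obtain i where "x = q i" using 0(4) by auto
  then show ?case using 0(3)[of i] B by simp
next
  case (Suc m)
  have B: "0 \<le> B" using Suc.prems(2)[of "q 0"] by simp
  obtain i y where y: "y \<in> V m" "x = F i y" using Suc.prems(4) by auto
  have mid: "\<bar>u (mid k)\<bar> \<le> M + B / 15" for k
  proof -
    have "\<bar>u (mid k)\<bar> \<le> (2 * M + 2 * M + M) / 5 + B / 15"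
      by (intro mid_bound[OF Suc.prems(1)] Suc.prems(2,3))
    then show ?thesis by simp
  qed
  have "\<bar>u (F i y)\<bar> \<le> (M + B / 15) + (B / 5) / 12"
  proof (rule Suc.IH[OF has_laplacian_sg_map[OF Suc.prems(1), of i] _ _ y(1)])
    show "\<bar>f (F i x) / 5\<bar> \<le> B / 5" if "x \<in> K" for x
      using Suc.prems(2)[OF sg_map_in_SG[OF that, of i]] by simp
    show "\<bar>u (F i (q j))\<bar> \<le> M + B / 15" for j
    proof (cases "i = j")
      case True
      then show ?thesis using Suc.prems(3)[of j] B by simp
    next
      case False
      then obtain k where "F i (q j) = mid k" by (rule sg_map_vertex_cases)
      then show ?thesis using mid by simp
    qed
  qed
  then show ?case by (simp add: y(2))
qed

text \<open>
  Values of \<open>u\<close> on the dense vertex set carry over by continuity. For \<open>B = 0\<close> this is the usual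
  maximum principle, and with \<open>M = 0\<close> the uniqueness of harmonic functions with given boundary
  values.
\<close>

lemma maximum_principle:
  assumes u: "has_laplacian q u f" and f: "\<And>x. x \<in> K \<Longrightarrow> \<bar>f x\<bar> \<le> B"
    and M: "\<And>i. \<bar>u (q i)\<bar> \<le> M" and x: "x \<in> K"
  shows "\<bar>u x\<bar> \<le> M + B / 12"
proof (rule continuous_le_on_closure[of "all_verts q" "\<lambda>x. \<bar>u x\<bar>"])
  show "continuous_on (closure (all_verts q)) (\<lambda>x. \<bar>u x\<bar>)"
    using u by (auto simp: has_laplacian_def SG_eq_closure intro!: continuous_intros)
  show "x \<in> closure (all_verts q)" using x by (simp add: SG_eq_closure)
  show "\<bar>u x\<bar> \<le> M + B / 12" if "x \<in> all_verts q" for x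
    using that bound_on_verts[OF u f M] by (auto simp: all_verts_def)
qed

text \<open>
  A corner of the subcell at \<open>q j\<close> is either \<open>q j\<close>, where \<open>u\<close> vanishes, or the midpoint of an edge
  at \<open>q j\<close>; there the harmonic weights leave \<open>2/5 + 1/5 = 3/5\<close> for the two other corners.
\<close>

lemma decay_step:
  assumes u: "has_laplacian q u f" and f: "\<And>x. x \<in> K \<Longrightarrow> \<bar>f x\<bar> \<le> B"
    and E: "\<And>x. x \<in> K \<Longrightarrow> \<bar>u x\<bar> \<le> E" and z: "u (q j) = 0" and x: "x \<in> K"
  shows "\<bar>u (F j x)\<bar> \<le> 3/5 * E + B / 12"
proof -
  have pos: "0 \<le> B" "0 \<le> E" using f[of "q 0"] E[of "q 0"] by auto
  have bd: "\<bar>u (F j (q i))\<bar> \<le> 3/5 * E + B / 15" for i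
  proof (cases "j = i")
    case True
    then show ?thesis using z pos by simp
  next
    case False
    then obtain k where k: "F j (q i) = mid k" by (rule sg_map_vertex_cases)
    have "\<bar>u (q (k + 1))\<bar> + \<bar>u (q (k - 1))\<bar> \<le> E"
      using sg_map_vertex_eq_mid[OF k] z E[of "q (k + 1)"] E[of "q (k - 1)"] by auto
    moreover have "\<bar>u (mid k)\<bar>
        \<le> (2 * \<bar>u (q (k + 1))\<bar> + 2 * \<bar>u (q (k - 1))\<bar> + E) / 5 + B / 15"
      by (intro mid_bound[OF u] f E order_refl vertex_in_SG)
    ultimately show ?thesis unfolding k by argo
  qed
  have "\<bar>f (F j x) / 5\<bar> \<le> B / 5" if "x \<in> K" for x
    using f[OF sg_map_in_SG[OF that, of j]] by simp
  then have "\<bar>u (F j x)\<bar> \<le> (3/5 * E + B / 15) + (B / 5) / 12"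
    using maximum_principle[OF has_laplacian_sg_map[OF u, of j] _ bd x] by blast
  then show ?thesis by simp
qed

text \<open>
  Each step turns the pair \<open>(E, B)\<close> into \<open>(3/5 * E + B/12, B/5)\<close>, and the sum of the two entries
  shrinks at least by the factor \<open>3/5\<close>.
\<close>

lemma decay:
  assumes "has_laplacian q u f" and "\<And>x. x \<in> K \<Longrightarrow> \<bar>f x\<bar> \<le> B"
    and "\<And>x. x \<in> K \<Longrightarrow> \<bar>u x\<bar> \<le> E" and "u (q j) = 0" and "x \<in> K"
  shows "\<bar>u ((F j ^^ m) x)\<bar> \<le> (E + B) * (3/5) ^ m"
  using assms
proof (induction m arbitrary: u f B E)
  case 0
  then have "0 \<le> B" using order_trans[OF abs_ge_zero 0(2)] by blast
  then show ?case using 0(3)[OF 0(5)] by simp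
next
  case (Suc m)
  have pos: "0 \<le> B" "0 \<le> E" using Suc.prems(2)[of "q 0"] Suc.prems(3)[of "q 0"] by auto
  have "\<bar>u (F j ((F j ^^ m) x))\<bar> \<le> ((3/5 * E + B / 12) + B / 5) * (3/5) ^ m"
  proof (rule Suc.IH[OF has_laplacian_sg_map[OF Suc.prems(1), of j]])
    show "\<bar>f (F j y) / 5\<bar> \<le> B / 5" if "y \<in> K" for y
      using Suc.prems(2)[OF sg_map_in_SG[OF that, of j]] by simp
    show "\<bar>u (F j y)\<bar> \<le> 3/5 * E + B / 12" if "y \<in> K" for y
      by (rule decay_step[OF Suc.prems(1-4) that])
  qed (use Suc.prems in auto)
  also have "\<dots> \<le> (3/5 * (E + B)) * (3/5) ^ m"
    using pos by (intro mult_right_mono) (auto simp: field_simps)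
  finally show ?case by (simp add: algebra_simps)
qed

section \<open>Symmetries of the gasket\<close>

text \<open>
  The affine map that permutes the vertices by \<open>p\<close>.
\<close>

definition relabel :: "(3 \<Rightarrow> 3) \<Rightarrow> real^2 \<Rightarrow> real^2" where
  "relabel p x = (\<Sum>i\<in>UNIV. bary i x *\<^sub>R q (p i))"

lemma relabel_vertex [simp]: "relabel p (q i) = q (p i)"
  unfolding relabel_def by (simp add: if_distrib[of "\<lambda>c. c *\<^sub>R _"] cong: if_cong)

lemma relabel_sg_map: "relabel p (F i x) = F (p i) (relabel p x)"
proof -
  have "relabel p (F i x) = (\<Sum>k\<in>UNIV. (1/2) *\<^sub>R (bary k x *\<^sub>R q (p k)
      + bary k (q i) *\<^sub>R q (p k)))"
    unfolding relabel_def
  proof (rule sum.cong[OF refl])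
    fix k
    have "((a + b) / 2) *\<^sub>R y = (1/2) *\<^sub>R (a *\<^sub>R y + b *\<^sub>R y)" for a b and y :: "real^2"
      by (simp add: scaleR_add_left[symmetric])
    then show "bary k (F i x) *\<^sub>R q (p k)
        = (1/2) *\<^sub>R (bary k x *\<^sub>R q (p k) + bary k (q i) *\<^sub>R q (p k))"
      unfolding bary_sg_map bary_vertex .
  qed
  also have "\<dots> = (1/2) *\<^sub>R (relabel p x + relabel p (q i))"
    unfolding relabel_def by (simp only: sum.distrib[symmetric] scaleR_sum_right)
  finally show ?thesis by (simp add: sg_map_def)
qed

lemma relabel_word: "relabel p (W w x) = W (map p w) (relabel p x)"
  by (induction w) (simp_all add: relabel_sg_map)

lemma relabel_iter: "relabel p ((F i ^^ m) x) = (F (p i) ^^ m) (relabel p x)"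
  by (induction m) (simp_all add: relabel_sg_map)

lemma continuous_relabel: "continuous_on S (relabel p)"
  unfolding relabel_def by (intro continuous_intros)

lemma relabel_in_verts: "x \<in> V m \<Longrightarrow> relabel p x \<in> V m"
proof (erule vertsE)
  fix w i assume "length w = m" "x = W w (q i)"
  then show "relabel p x \<in> V m"
    using sg_word_in_verts[of q "map p w" "p i"] by (simp add: relabel_word)
qed

lemma relabel_in_SG:
  assumes "x \<in> K"
  shows "relabel p x \<in> K"
proof -
  have "relabel p ` all_verts q \<subseteq> closure (all_verts q)"
    using closure_subset[of "all_verts q"] relabel_in_verts unfolding all_verts_def by blast
  then have "relabel p ` closure (all_verts q) \<subseteq> closure (all_verts q)"
    by (intro image_closure_subset continuous_relabel closed_closure)
  then show ?thesis using assms by (auto simp: SG_eq_closure)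
qed

lemma relabel_inverse:
  assumes "bij p" "x \<in> V m"
  shows "relabel (inv p) (relabel p x) = x"
proof -
  have "inv p \<circ> p = id" using assms(1) by (simp add: bij_is_inj)
  then have "map (inv p) (map p w) = w" "inv p (p i) = i" for w i
    by (auto simp: pointfree_idE)
  then show ?thesis using assms(2) by (auto elim!: vertsE simp: relabel_word simp del: map_map)
qed

lemma relabel_interior:
  assumes "bij p" "x \<in> V m - V 0"
  shows "relabel p x \<in> V m - V 0"
proof -
  have "x \<in> V 0" if "relabel p x \<in> V 0"
    using relabel_inverse[OF assms(1), of x m] assms(2) relabel_in_verts[OF that, of "inv p"]
    by auto
  then show ?thesis using assms(2) relabel_in_verts by blast
qed

lemma addr_relabel:
  assumes p: "bij p" and x: "x \<in> V m"
  shows "addr n (relabel p x) = (\<lambda>(w, i). (map p w, p i)) ` addr n x"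
proof
  show "(\<lambda>(w, i). (map p w, p i)) ` addr n x \<subseteq> addr n (relabel p x)"
    by (auto simp: relabel_word)
  show "addr n (relabel p x) \<subseteq> (\<lambda>(w, i). (map p w, p i)) ` addr n x"
  proof
    fix a assume "a \<in> addr n (relabel p x)"
    then obtain w i where a: "a = (w, i)" "length w = n" "W w (q i) = relabel p x" by (cases a) auto
    have "p \<circ> inv p = id" using p by (simp add: bij_is_surj surj_iff[symmetric])
    then have inv: "map p (map (inv p) w) = w" "p (inv p i) = i"
      by (auto simp: pointfree_idE)
    have "W (map (inv p) w) (q (inv p i)) = relabel (inv p) (W w (q i))"
      by (simp add: relabel_word)
    also have "\<dots> = x" unfolding a(3) by (rule relabel_inverse[OF p x])
    finally have "(map (inv p) w, inv p i) \<in> addr n x" using a(2) by simp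
    then show "a \<in> (\<lambda>(w, i). (map p w, p i)) ` addr n x"
      using inv a(1) by (intro image_eqI[of _ _ "(map (inv p) w, inv p i)"]) (simp_all del: map_map)
  qed
qed

lemma corner_relabel:
  assumes "bij p"
  shows "corner u (map p w) (p i) = corner (\<lambda>x. u (relabel p x)) w i"
  unfolding corner_def using assms
  by (subst sum.reindex_bij_betw[of p UNIV UNIV, symmetric]) (auto simp: relabel_word)

lemma lap_relabel:
  assumes p: "bij p" and x: "x \<in> V m"
  shows "lap n u (relabel p x) = lap n (\<lambda>x. u (relabel p x)) x"
proof -
  have "inj p" using p by (rule bij_is_inj)
  then have "inj_on (\<lambda>(w, i). (map p w, p i)) (addr n x)"
    by (auto simp: inj_on_def inj_def dest: map_injective)
  then show ?thesis
    unfolding lap_eq_corners addr_relabel[OF p x]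
    by (subst sum.reindex) (auto simp: case_prod_beta' corner_relabel[OF p])
qed

lemma has_laplacian_relabel:
  assumes u: "has_laplacian q u f" and p: "bij p"
  shows "has_laplacian q (\<lambda>x. u (relabel p x)) (\<lambda>x. f (relabel p x))"
  unfolding has_laplacian_def
proof (intro conjI allI impI)
  have "continuous_on K (\<lambda>x. g (relabel p x))" if "continuous_on K g" for g :: "real^2 \<Rightarrow> real"
    by (rule continuous_on_compose2[OF that continuous_relabel]) (auto intro: relabel_in_SG)
  then show "continuous_on K (\<lambda>x. u (relabel p x))" "continuous_on K (\<lambda>x. f (relabel p x))"
    using u by (auto simp: has_laplacian_def)
  fix e :: real assume "e > 0"
  then have "\<forall>\<^sub>F m in sequentially. \<forall>x\<in>V m - V 0. \<bar>discrete_laplacian q m u x - f x\<bar> < e"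
    using u by (simp add: has_laplacian_def)
  then show "\<forall>\<^sub>F m in sequentially. \<forall>x\<in>V m - V 0.
      \<bar>discrete_laplacian q m (\<lambda>x. u (relabel p x)) x - f (relabel p x)\<bar> < e"
  proof (rule eventually_mono, intro ballI)
    fix m x
    assume *: "\<forall>x\<in>V m - V 0. \<bar>discrete_laplacian q m u x - f x\<bar> < e" and x: "x \<in> V m - V 0"
    show "\<bar>discrete_laplacian q m (\<lambda>x. u (relabel p x)) x - f (relabel p x)\<bar> < e"
      using *[rule_format, OF relabel_interior[OF p x]] lap_relabel[OF p DiffD1[OF x]]
      by (simp add: discrete_laplacian_eq)
  qed
qed

lemma bij_reflect: "bij (\<lambda>i::3. k - i)"
  by (rule involuntory_imp_bij) simp

lemma bij_rotate: "bij (\<lambda>i::3. k + i)"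
  by simp

section \<open>Existence of tangential derivatives\<close>

text \<open>
  The harmonic rule shrinks the difference of the values at \<open>q (j + 1)\<close> and \<open>q (j - 1)\<close> to exactly
  \<open>1/5\<close> of itself. The correction is the difference of the graph Laplacian at two midpoints
  exchanged by the reflection about \<open>q j\<close>, that is, the graph Laplacian of \<open>v\<close> minus its mirror
  image. Its Laplacian is \<open>f\<close> minus the mirror image of \<open>f\<close>, so constants drop out and only the
  deviation of \<open>f\<close> from \<open>c\<close> matters.
\<close>

lemma tangential_step:
  assumes v: "has_laplacian q v f" and f: "\<And>x. x \<in> K \<Longrightarrow> \<bar>f x - c\<bar> \<le> B"
  shows "\<bar>5 * (v (F j (q (j + 1))) - v (F j (q (j - 1)))) - (v (q (j + 1)) - v (q (j - 1)))\<bar> \<le> B"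
proof -
  \<comment> \<open>the reflection that fixes \<open>j\<close> and swaps the other two vertices\<close>
  define p where "p = (\<lambda>i. (j + j) - i)"
  define \<tau> where "\<tau> = relabel p"
  have p: "bij p" "p j = j" "p (j + 1) = j - 1"
    unfolding p_def by (rule bij_reflect) (simp_all add: algebra_simps)
  have B: "0 \<le> B" using f[of "q 0"] by simp
  have m: "F j (q (j + 1)) = mid (j - 1)" "F j (q (j - 1)) = mid (j + 1)"
    using mid_alt[of "j + 1"] by (auto simp: mid_def)
  have "\<tau> (mid (j - 1)) = F j (q (j - 1))"
    unfolding \<tau>_def m(1)[symmetric] by (simp add: relabel_sg_map p)
  then have \<tau>m: "\<tau> (mid (j - 1)) = mid (j + 1)" by (simp only: m)
  have int: "mid (j - 1) \<in> V (Suc 0) - V 0" using word_mid_interior[of "[]" "j - 1"] by simp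
  have "has_laplacian q (\<lambda>x. v x - v (\<tau> x)) (\<lambda>x. f x - f (\<tau> x))"
    unfolding \<tau>_def by (intro has_laplacian_diff has_laplacian_relabel v p)
  moreover have "\<bar>f x - f (\<tau> x)\<bar> \<le> 2 * B" if "x \<in> K" for x
    using f[OF that] f[OF relabel_in_SG[OF that], of p]
    unfolding abs_le_iff \<tau>_def by - (elim conjE, intro conjI; linarith)
  ultimately have "\<bar>lap (Suc 0) (\<lambda>x. v x - v (\<tau> x)) (mid (j - 1))\<bar> \<le> 2/3 * (2 * B) / 5 ^ Suc 0"
    by (intro lap_bound[OF _ _ int])
  moreover have "lap (Suc 0) (\<lambda>x. v x - v (\<tau> x)) (mid (j - 1))
      = lap (Suc 0) v (mid (j - 1)) - lap (Suc 0) v (mid (j + 1))"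
    using lap_lincomb[of "Suc 0" 1 v "-1" "\<lambda>x. v (\<tau> x)" "mid (j - 1)"]
      lap_relabel[OF p(1) DiffD1[OF int], of "Suc 0" v, folded \<tau>_def]
    by (simp add: \<tau>m)
  moreover have "5 * (v (mid (j - 1)) - v (mid (j + 1))) - (v (q (j + 1)) - v (q (j - 1)))
      = - (lap (Suc 0) v (mid (j - 1)) - lap (Suc 0) v (mid (j + 1)))"
    using mid_value[of v "[]" "j - 1"] mid_value[of v "[]" "j + 1"] by simp argo
  ultimately have "\<bar>5 * (v (mid (j - 1)) - v (mid (j + 1))) - (v (q (j + 1)) - v (q (j - 1)))\<bar>
      \<le> 2/3 * (2 * B) / 5 ^ Suc 0"
    by (simp only: abs_minus_cancel)
  then show ?thesis using B unfolding m by simp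
qed

lemma has_laplacian_iter:
  assumes "has_laplacian q u f"
  shows "has_laplacian q (\<lambda>x. u ((F j ^^ m) x)) (\<lambda>x. f ((F j ^^ m) x) / 5 ^ m)"
proof (induction m)
  case 0
  then show ?case using assms by simp
next
  case (Suc m)
  show ?case using has_laplacian_sg_map[OF Suc, of j] by (simp add: funpow_swap1 mult.commute)
qed

lemma continuous_bounded_on_SG:
  assumes "continuous_on K f"
  obtains B :: real where "\<And>x. x \<in> K \<Longrightarrow> \<bar>f x\<bar> \<le> B"
proof -
  have "bounded (f ` K)"
    by (intro compact_imp_bounded compact_continuous_image assms compact_SG)
  then show ?thesis using that by (auto simp: bounded_iff)
qed

text \<open>
  Zooming in on \<open>q j\<close>, consecutive quotients differ by at most the oscillation of \<open>f\<close> on the cell,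
  and \<open>decay\<close> makes those oscillations a convergent geometric series.
\<close>

lemma tangentially_differentiable_dom2:
  assumes u: "has_laplacian q u f" and f: "has_laplacian q f g"
  shows "tangentially_differentiable q u j"
proof -
  \<comment> \<open>\<open>decay\<close> applies to functions that vanish at \<open>q j\<close>\<close>
  define h where "h = (\<lambda>x. f x - f (q j))"
  have h: "has_laplacian q h g"
    using has_laplacian_diff[OF f has_laplacian_const[of "f (q j)"]] by (simp add: h_def)
  obtain E where E: "\<bar>h x\<bar> \<le> E" if "x \<in> K" for x
    using h continuous_bounded_on_SG[of h] by (auto simp: has_laplacian_def)
  obtain B where B: "\<bar>g x\<bar> \<le> B" if "x \<in> K" for x
    using h continuous_bounded_on_SG[of g] by (auto simp: has_laplacian_def)
  let ?T = "tangential_quotient q u j"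
  have "\<bar>?T (Suc m) - ?T m\<bar> \<le> (E + B) * (3/5) ^ m" for m
  proof -
    let ?v = "\<lambda>x. u ((F j ^^ m) x)"
    have "\<bar>5 * (?v (F j (q (j + 1))) - ?v (F j (q (j - 1)))) - (?v (q (j + 1)) - ?v (q (j - 1)))\<bar>
        \<le> (E + B) * (3/5) ^ m / 5 ^ m"
    proof (rule tangential_step[OF has_laplacian_iter[OF u]])
      fix x assume "x \<in> K"
      then have "\<bar>h ((F j ^^ m) x)\<bar> \<le> (E + B) * (3/5) ^ m"
        using h B E by (intro decay) (auto simp: h_def)
      then have "\<bar>h ((F j ^^ m) x)\<bar> / 5 ^ m \<le> (E + B) * (3/5) ^ m / 5 ^ m"
        by (intro divide_right_mono) auto
      moreover have "\<bar>f ((F j ^^ m) x) / 5 ^ m - f (q j) / 5 ^ m\<bar> = \<bar>h ((F j ^^ m) x)\<bar> / 5 ^ m"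
        by (simp add: h_def diff_divide_distrib[symmetric])
      ultimately show "\<bar>f ((F j ^^ m) x) / 5 ^ m - f (q j) / 5 ^ m\<bar> \<le> (E + B) * (3/5) ^ m / 5 ^ m"
        by simp
    qed
    then have "5 ^ m * \<bar>5 * (?v (F j (q (j + 1))) - ?v (F j (q (j - 1))))
        - (?v (q (j + 1)) - ?v (q (j - 1)))\<bar> \<le> (E + B) * (3/5) ^ m"
      by (simp only: pos_le_divide_eq zero_less_power zero_less_numeral mult.commute)
    moreover have "?T (Suc m) - ?T m = 5 ^ m * (5 * (?v (F j (q (j + 1))) - ?v (F j (q (j - 1))))
        - (?v (q (j + 1)) - ?v (q (j - 1))))"
      by (simp add: tangential_quotient_def funpow_swap1 algebra_simps)
    ultimately show ?thesis by (simp add: abs_mult)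
  qed
  then have "summable (\<lambda>m. ?T (Suc m) - ?T m)"
    by (intro summable_comparison_test'[OF summable_mult[OF summable_geometric[of "3/5"]],
          of 0 _ "E + B"]) auto
  then have "(\<lambda>n. \<Sum>m<n. ?T (Suc m) - ?T m) \<longlonglongrightarrow> (\<Sum>m. ?T (Suc m) - ?T m)"
    by (rule summable_LIMSEQ)
  then have "(\<lambda>n. (?T n - ?T 0) + ?T 0) \<longlonglongrightarrow> (\<Sum>m. ?T (Suc m) - ?T m) + ?T 0"
    unfolding sum_lessThan_telescope by (intro tendsto_intros)
  then show ?thesis
    by (auto simp: tangentially_differentiable_def convergent_def)
qed

section \<open>Cancellation for polynomials\<close>

text \<open>
  The alternating sum over the symmetric group: the even permutations of the integers mod 3 are
  the rotations \<open>i \<mapsto> k + i\<close>, the odd ones the reflections \<open>i \<mapsto> k - i\<close>.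
\<close>

definition antisym :: "(real^2 \<Rightarrow> real) \<Rightarrow> real^2 \<Rightarrow> real" where
  "antisym u x = (\<Sum>k\<in>UNIV. u (relabel (\<lambda>i. k + i) x) - u (relabel (\<lambda>i. k - i) x))"

text \<open>
  At a vertex, the rotations and the reflections each produce the three vertex values once.
\<close>

lemma antisym_vertex: "antisym u (q i) = 0"
proof -
  have "(\<Sum>k\<in>UNIV. u (q (k + i))) = (\<Sum>k\<in>UNIV. u (q k))"
    by (rule sum.reindex_bij_witness[of _ "\<lambda>k. k - i" "\<lambda>k. k + i"]) auto
  moreover have "(\<Sum>k\<in>UNIV. u (q (k - i))) = (\<Sum>k\<in>UNIV. u (q k))"
    by (rule sum.reindex_bij_witness[of _ "\<lambda>k. k + i" "\<lambda>k. k - i"]) auto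
  ultimately show ?thesis by (simp add: antisym_def sum_subtractf)
qed

lemma has_laplacian_antisym:
  "has_laplacian q u f \<Longrightarrow> has_laplacian q (antisym u) (antisym f)"
  unfolding antisym_def
  by (intro has_laplacian_sum has_laplacian_diff has_laplacian_relabel bij_reflect bij_rotate) auto

text \<open>
  Harmonic with zero boundary values once the claim is known for the Laplacian of \<open>u\<close>.
\<close>

lemma antisym_polynomial:
  assumes "has_laplacian_power q n u (\<lambda>_. 0)" "x \<in> K"
  shows "antisym u x = 0"
  using assms
proof (induction n arbitrary: u x)
  case 0
  then show ?case by (simp add: antisym_def relabel_in_SG)
next
  case (Suc n)
  then obtain g where g: "has_laplacian q u g" "has_laplacian_power q n g (\<lambda>_. 0)" by auto
  have "\<bar>antisym u x\<bar> \<le> 0 + 0 / 12"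
    using Suc.IH[OF g(2)] antisym_vertex Suc.prems(2)
    by (intro maximum_principle[OF has_laplacian_antisym[OF g(1)]]) auto
  then show ?case by simp
qed

text \<open>
  The rotations send \<open>F\<^sub>0\<^sup>m q\<^sub>1\<close> to \<open>F\<^sub>k\<^sup>m q\<^sub>k\<^sub>+\<^sub>1\<close> and the reflections send it to \<open>F\<^sub>k\<^sup>m
  q\<^sub>k\<^sub>-\<^sub>1\<close>: the alternating sum at this single point contains all three difference quotients.
\<close>

lemma sum_tangential_quotient:
  assumes "sg_polynomial q P"
  shows "(\<Sum>k\<in>UNIV. tangential_quotient q P k m) = 0"
proof -
  obtain n where n: "has_laplacian_power q n P (\<lambda>_. 0)" using assms by (auto simp: sg_polynomial_def)
  have "(F 0 ^^ m) (q 1) \<in> K" by (induction m) (auto intro: sg_map_in_SG)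
  then have "0 = 5 ^ m * antisym P ((F 0 ^^ m) (q 1))" using antisym_polynomial[OF n] by simp
  also have "\<dots> = (\<Sum>k\<in>UNIV. tangential_quotient q P k m)"
    by (simp add: antisym_def relabel_iter tangential_quotient_def sum_distrib_left)
  finally show ?thesis by simp
qed

lemma has_laplacian_zero:
  assumes "\<And>x. x \<in> K \<Longrightarrow> u x = 0"
  shows "has_laplacian q u (\<lambda>_. 0)"
proof -
  have "continuous_on K u" using continuous_on_cong[of K K u "\<lambda>_. 0"] assms by simp
  moreover have "discrete_laplacian q m u x = 0" if "x \<in> V m" for m x
    unfolding discrete_laplacian_def using assms that verts_subset_SG[of q m]
    by (auto simp: adjacent_def subset_iff intro!: sum.neutral)
  ultimately show ?thesis by (auto simp: has_laplacian_def)
qed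

text \<open>
  A polynomial may be annihilated by \<open>\<Delta>\<^sup>0\<close> or \<open>\<Delta>\<^sup>1\<close>; the zero function on the gasket then supplies
  the further Laplacians.
\<close>

lemma polynomial_dom2:
  assumes "sg_polynomial q P"
  obtains f g where "has_laplacian q P f" "has_laplacian q f g"
proof -
  obtain n where n: "has_laplacian_power q n P (\<lambda>_. 0)" using assms by (auto simp: sg_polynomial_def)
  have dom: "\<exists>g. has_laplacian q u g \<and> (\<exists>k. has_laplacian_power q k g (\<lambda>_. 0))"
    if "has_laplacian_power q k u (\<lambda>_. 0)" for k u
  proof (cases k)
    case 0
    then have "has_laplacian q u (\<lambda>_. 0)" using that has_laplacian_zero by simp
    moreover have "has_laplacian_power q 0 (\<lambda>_. 0) (\<lambda>_. 0)" by simp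
    ultimately show ?thesis by blast
  next
    case (Suc l)
    then show ?thesis using that by auto
  qed
  show thesis using dom[OF n] dom that by blast
qed

lemma tangential_sum_polynomial:
  assumes "sg_polynomial q P"
  shows "tangentially_differentiable q P j"
    and "tangential_deriv q P 0 + tangential_deriv q P 1 + tangential_deriv q P 2 = 0"
proof -
  obtain f g where fg: "has_laplacian q P f" "has_laplacian q f g"
    using assms by (rule polynomial_dom2)
  show diff: "tangentially_differentiable q P j" for j
    by (rule tangentially_differentiable_dom2[OF fg])
  have "(\<lambda>m. \<Sum>k\<in>UNIV. tangential_quotient q P k m) \<longlonglongrightarrow> (\<Sum>k\<in>UNIV. tangential_deriv q P k)"
    using diff by (intro tendsto_sum)
      (simp add: tangentially_differentiable_def tangential_deriv_def convergent_LIMSEQ_iff)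
  then have "(\<Sum>k\<in>UNIV. tangential_deriv q P k) = 0"
    using LIMSEQ_unique tendsto_const unfolding sum_tangential_quotient[OF assms] by blast
  moreover have two: "(2::3) = 0 - 1" by simp
  ultimately show "tangential_deriv q P 0 + tangential_deriv q P 1 + tangential_deriv q P 2 = 0"
    unfolding two sum_three[of _ 0] by (simp only: add_0)
qed

lemma has_laplacian_power_cmult:
  "has_laplacian_power q n u (\<lambda>_. 0) \<Longrightarrow> has_laplacian_power q n (\<lambda>x. c * u x) (\<lambda>_. 0)"
  by (induction n arbitrary: u) (auto intro: has_laplacian_cmult)

lemma has_laplacian_power_sg_map:
  "has_laplacian_power q n u (\<lambda>_. 0) \<Longrightarrow> has_laplacian_power q n (\<lambda>x. u (F i x)) (\<lambda>_. 0)"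
proof (induction n arbitrary: u)
  case 0
  then show ?case by (simp add: sg_map_in_SG)
next
  case (Suc n)
  then obtain g where g: "has_laplacian q u g" "has_laplacian_power q n g (\<lambda>_. 0)" by auto
  have "has_laplacian_power q n (\<lambda>x. (1/5) * g (F i x)) (\<lambda>_. 0)"
    by (rule has_laplacian_power_cmult[OF Suc.IH[OF g(2)]])
  then show ?case using has_laplacian_sg_map[OF g(1), of i] by auto
qed

lemma sg_polynomial_word:
  "sg_polynomial q P \<Longrightarrow> sg_polynomial q (P \<circ> W w)"
proof (induction w arbitrary: P)
  case Nil
  then show ?case by simp
next
  case (Cons i w)
  have "sg_polynomial q (P \<circ> F i)"
    using Cons.prems has_laplacian_power_sg_map[of _ P i]
    by (auto simp: sg_polynomial_def comp_def)
  then show ?case using Cons.IH[of "P \<circ> F i"] by (simp only: comp_assoc sg_word.simps)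
qed

end

theorem corollary2p6:
  fixes q :: "3 \<Rightarrow> real^2" and P :: "real^2 \<Rightarrow> real"
  assumes "equilateral q"
    and "sg_polynomial q P"
  shows "((\<forall>j. tangentially_differentiable q P j) \<and>
           tangential_deriv q P 0 + tangential_deriv q P 1 + tangential_deriv q P 2 = 0) \<and>
         (\<forall>w. (\<forall>j. tangentially_differentiable q (P \<circ> sg_word q w) j) \<and>
           cell_tangential_deriv q w P 0 + cell_tangential_deriv q w P 1
             + cell_tangential_deriv q w P 2 = 0)"
proof -
  interpret gasket q using assms(1) by unfold_locales
  have "cell_tangential_deriv q w P 0 + cell_tangential_deriv q w P 1
      + cell_tangential_deriv q w P 2 = 0" for w
    using tangential_sum_polynomial(2)[OF sg_polynomial_word[OF assms(2), of w]]
    by (simp add: cell_tangential_deriv_def distrib_left[symmetric])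
  then show ?thesis
    using tangential_sum_polynomial[OF assms(2)]
      tangential_sum_polynomial(1)[OF sg_polynomial_word[OF assms(2)]] by blast
qed

end
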